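(* Consider a sequence $\{F_n\}_n$ in $\Delta_+$ and a sequence $\{k_n\}_n$ of positive integers with $k_1<k_2<\cdots$. The following conditions are equivalent. (1) There exists $F\in\Delta_+$ such that $\overbrace{F_n\vee\cdots\vee F_n}^{k_n\text{ times}}\xrightarrow{w}F$ as $n\to\infty$. (2) There exists $G\in\Delta_+$ such that $\overbrace{F_n\,\cup_\vee\cdots\cup_\vee\,F_n}^{k_n\text{ times}}\xrightarrow{w}G$ as $n\to\infty$.
   Context: $\Delta_+$ is the set of all (cumulative) distribution functions $F$ of probability measures on $\mathbb{R}$ with $F(x)=0$ for all $x<0$ (an atom at $0$ is allowed). $\xrightarrow{w}$ denotes weak convergence, i.e. pointwise convergence at every continuity point of the limit distribution function. (Classical) max-convolution: $F\vee G=FG$ (pointwise product), so the $k$-fold max-convolution of $F$ with itself is $F^k$. Boolean max-convolution: for $x,y\in[0,1]$, $x\cup_\vee y$ is defined by $(x\cup_\vee y)^{-1}-1=(x^{-1}-1)+(y^{-1}-1)$ if $x,y>0$, and $x\cup_\vee y=0$ if $x=0$ or $y=0$. For $F,G\in\Delta_+$, $(F\cup_\vee G)(x)=F(x)\cup_\vee G(x)$. The $k$-fold Boolean max-convolution of $F$ with itself equals $\dfrac{F}{k-(k-1)F}$. *)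

theory Defs
  imports "HOL-Probability.Probability"
begin

definition Delta_plus :: "(real \<Rightarrow> real) set" where
  "Delta_plus = {F. (\<exists>M. real_distribution M \<and> F = cdf M) \<and> (\<forall>x<0. F x = 0)}"

definition max_conv :: "(real \<Rightarrow> real) \<Rightarrow> (real \<Rightarrow> real) \<Rightarrow> real \<Rightarrow> real" where
  "max_conv F G = (\<lambda>x. F x * G x)"

text \<open>The operation below is only meaningful for arguments in the unit interval.  On positive
  arguments its value is the solution \<open>z\<close> of \<open>1/z - 1 = (1/x - 1) + (1/y - 1)\<close>;
  see \<open>bool_max_char\<close>.\<close>

definition bool_max :: "real \<Rightarrow> real \<Rightarrow> real" where
  "bool_max x y =
     (if x > 0 \<and> y > 0 then inverse (((inverse x - 1) + (inverse y - 1)) + 1) else 0)"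

definition bool_max_conv :: "(real \<Rightarrow> real) \<Rightarrow> (real \<Rightarrow> real) \<Rightarrow> real \<Rightarrow> real" where
  "bool_max_conv F G = (\<lambda>x. bool_max (F x) (G x))"

text \<open>The \<open>k\<close>-fold convolution \<open>F * \<dots> * F\<close> with \<open>k\<close> factors, for \<open>k \<ge> 1\<close>;
  the value at \<open>k = 0\<close> is junk.\<close>

definition conv_power :: "('a \<Rightarrow> 'a \<Rightarrow> 'a) \<Rightarrow> nat \<Rightarrow> 'a \<Rightarrow> 'a" where
  "conv_power c k F = (c F ^^ (k - 1)) F"

lemma bool_max_char:
  assumes "0 < x" "x \<le> 1" "0 < y" "y \<le> 1"
  shows "0 < bool_max x y" "bool_max x y \<le> 1"
    and "inverse (bool_max x y) - 1 = (inverse x - 1) + (inverse y - 1)"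
proof -
  have "inverse x \<ge> 1" "inverse y \<ge> 1"
    using assms by (auto simp: one_le_inverse_iff)
  then show "0 < bool_max x y" "bool_max x y \<le> 1"
      "inverse (bool_max x y) - 1 = (inverse x - 1) + (inverse y - 1)"
    using assms by (auto simp: bool_max_def inverse_le_1_iff)
qed

lemma conv_power_Suc:
  "k \<ge> 1 \<Longrightarrow> conv_power c (Suc k) F = c F (conv_power c k F)"
  by (cases k) (auto simp: conv_power_def)

lemma conv_power_max_conv:
  assumes "k \<ge> 1"
  shows "conv_power max_conv k F = (\<lambda>x. F x ^ k)"
  using assms
proof (induction k rule: dec_induct)
  case base
  show ?case by (simp add: conv_power_def)
next
  case (step k)
  then show ?case by (simp add: conv_power_Suc max_conv_def)
qed

lemma conv_power_bool_max_conv: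
  assumes "k \<ge> 1" and F: "\<And>x. 0 \<le> F x" "\<And>x. F x \<le> 1"
  shows "conv_power bool_max_conv k F = (\<lambda>x. F x / (real k - (real k - 1) * F x))"
  using assms(1)
proof (induction k rule: dec_induct)
  case base
  show ?case by (simp add: conv_power_def)
next
  case (step k)
  have "bool_max (F x) (F x / (real k - (real k - 1) * F x))
      = F x / (real (Suc k) - (real (Suc k) - 1) * F x)" for x
  proof (cases "F x = 0")
    case True
    then show ?thesis by (simp add: bool_max_def)
  next
    case False
    then have p: "0 < F x" using F(1)[of x] by simp
    have "(real k - 1) * F x \<le> (real k - 1) * 1"
      using step.hyps F(2)[of x] by (intro mult_left_mono) auto
    then have q: "0 < real k - (real k - 1) * F x" by simp
    have "inverse (F x) - 1 + (inverse (F x / (real k - (real k - 1) * F x)) - 1) + 1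
        = (real (Suc k) - (real (Suc k) - 1) * F x) / F x"
      using p q by (simp add: field_simps)
    then show ?thesis
      using p q by (simp add: bool_max_def)
  qed
  then show ?case
    using step by (simp add: conv_power_Suc bool_max_conv_def)
qed

end

theory Submission
  imports Defs "HOL-Real_Asymp.Real_Asymp"
begin

text \<open>The map \<open>\<phi>(t) = 1 / (1 - ln t)\<close>, with \<open>\<phi>(0) = 0\<close>, is an increasing homeomorphism of the
  unit interval that turns multiplication into \<open>bool_max\<close>, because \<open>1/\<phi>(t) - 1 = -ln t\<close> is
  additive.  So it identifies the two convolutions abstractly, and \<open>G = \<phi> \<circ> H\<close> is the
  natural candidate for the correspondence between limits.  What needs an argument is that
  the \<^emph>\<open>same\<close> sequence \<open>F\<^sub>n\<close> serves on both sides: the \<open>k\<close>-fold classical power of \<open>p\<close> is sent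
  by \<open>\<phi>\<close> to the \<open>k\<close>-fold Boolean power of \<open>\<phi>(p)\<close>, not of \<open>p\<close>.  But near \<open>p = 1\<close>, which
  is all that matters for large \<open>k\<close>, \<open>\<phi>(p)\<close> and \<open>p\<close> agree to first order.  Quantitatively, \<open>\<phi>(p\<^sup>k)\<close> and the
  \<open>k\<close>-fold Boolean power of \<open>p\<close> differ by at most \<open>1/k\<close>, uniformly in \<open>p\<close>
  (\<open>boolean_power_error\<close>).  As \<open>k\<^sub>n \<rightarrow> \<infinity>\<close>, at each point one sequence of powers tends to \<open>h\<close> iff the
  other tends to \<open>\<phi>(h)\<close>.

  Since \<open>\<phi>\<close> and its inverse are continuous, increasing and fix \<open>0\<close> and \<open>1\<close>, composing with them
  preserves \<open>Delta_plus\<close> (\<open>Delta_plus_compose\<close>) and the set of continuity points, so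
  the pointwise equivalence passes to weak convergence (\<open>weak_conv_transport\<close>).\<close>

section \<open>The homeomorphism between the two semigroups\<close>

definition to_boolean :: "real \<Rightarrow> real" where
  "to_boolean t = (if t = 0 then 0 else 1 / (1 - ln t))"

definition to_classical :: "real \<Rightarrow> real" where
  "to_classical s = (if s = 0 then 0 else exp (1 - 1 / s))"

lemma to_boolean_bounds:
  assumes "t \<in> {0..1}"
  shows "to_boolean t \<in> {0..1}"
proof (cases "t = 0")
  case False
  then have "ln t \<le> 0" using assms by simp
  then show ?thesis by (simp add: to_boolean_def)
qed (simp add: to_boolean_def)

lemma to_classical_bounds: "s \<in> {0..1} \<Longrightarrow> to_classical s \<in> {0..1}"
  by (auto simp: to_classical_def)

lemma to_classical_to_boolean:
  assumes "t \<in> {0..1}"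
  shows "to_classical (to_boolean t) = t"
proof (cases "t = 0")
  case False
  then have "ln t \<le> 0" using assms by simp
  then have "ln t \<noteq> 1" by simp
  then show ?thesis using False assms by (simp add: to_boolean_def to_classical_def)
qed (simp add: to_boolean_def to_classical_def)

lemma to_boolean_to_classical: "to_boolean (to_classical s) = s"
  by (simp add: to_boolean_def to_classical_def)

lemma mono_to_boolean: "mono_on {0..1} to_boolean"
proof (rule mono_onI)
  fix s t :: real
  assume st: "s \<in> {0..1}" "t \<in> {0..1}" "s \<le> t"
  show "to_boolean s \<le> to_boolean t"
  proof (cases "s = 0")
    case True
    then show ?thesis using to_boolean_bounds[OF st(2)] by (simp add: to_boolean_def)
  next
    case False
    then have "ln s \<le> ln t" "ln t \<le> 0" using st by auto
    then have "1 / (1 - ln s) \<le> 1 / (1 - ln t)" by (intro frac_le) auto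
    then show ?thesis using False st by (simp add: to_boolean_def)
  qed
qed

lemma mono_to_classical: "mono_on {0..1} to_classical"
  by (rule mono_onI) (auto simp: to_classical_def intro!: divide_left_mono)

lemma continuous_to_classical: "continuous_on {0..1} to_classical"
proof -
  have "continuous (at s within {0..1}) to_classical" if s: "s \<in> {0..1}" for s
  proof (cases "s = 0")
    case True
    have lim: "((\<lambda>s::real. exp (1 - 1 / s)) \<longlongrightarrow> 0) (at_right 0)"
      by real_asymp
    have "(to_classical \<longlongrightarrow> 0) (at_right 0)"
      by (rule Lim_transform_eventually[OF lim])
        (auto simp: to_classical_def eventually_at_filter)
    then show ?thesis
      using True by (simp add: continuous_within to_classical_def at_within_Icc_at_right)
  next
    case False
    have "continuous (at s) (\<lambda>s. exp (1 - 1 / s))"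
      using False by (intro continuous_intros)
    moreover have "eventually (\<lambda>u. u \<noteq> 0) (nhds s)"
      using False by (rule t1_space_nhds)
    then have "eventually (\<lambda>u. exp (1 - 1 / u) = to_classical u) (nhds s)"
      by eventually_elim (simp add: to_classical_def)
    ultimately have "continuous (at s) to_classical"
      using isCont_cong[of "\<lambda>u. exp (1 - 1 / u)" to_classical s] by simp
    then show ?thesis by (rule continuous_at_imp_continuous_at_within)
  qed
  then show ?thesis by (simp add: continuous_on_eq_continuous_within)
qed

text \<open>Inherited from the inverse, which lives on a compact set.\<close>

lemma continuous_to_boolean: "continuous_on {0..1} to_boolean"
proof -
  have "to_classical ` {0..1} = {0..1}"
  proof (intro subset_antisym subsetI)
    fix t :: real assume t: "t \<in> {0..1}"
    show "t \<in> to_classical ` {0..1}"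
      using to_classical_to_boolean[OF t] to_boolean_bounds[OF t] by (metis imageI)
  qed (use to_classical_bounds in auto)
  then show ?thesis
    using continuous_on_inv[OF continuous_to_classical, of to_boolean] to_boolean_to_classical
    by simp
qed

section \<open>Comparing powers of one number\<close>

text \<open>For \<open>p > 0\<close> write \<open>u = -ln p\<close> and \<open>v = 1/p - 1\<close>, so that \<open>\<phi>(p\<^sup>k) = 1/(1 + k u)\<close> while the Boolean
  power is \<open>1/(1 + k v)\<close>.  Both bounds come from \<open>ln x \<le> x - 1\<close>: at \<open>x = 1/p\<close> it says
  \<open>u \<le> v\<close>, at \<open>x = p\<close> it says \<open>v - u \<le> u v\<close>.  The difference
  \<open>k (v - u) / ((1 + k u) (1 + k v))\<close> then has a numerator of at most \<open>k u v\<close> and a denominator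
  of at least \<open>k\<^sup>2 u v\<close>.\<close>

lemma boolean_power_error:
  assumes p: "p \<in> {0..1}" and k: "k > 0"
  shows "\<bar>p / (real k - (real k - 1) * p) - to_boolean (p ^ k)\<bar> \<le> 1 / real k"
proof (cases "p = 0")
  case True
  then show ?thesis using k by (simp add: to_boolean_def)
next
  case False
  then have p0: "0 < p" using p by simp
  define K u v where "K = real k" and "u = - ln p" and "v = 1 / p - 1"
  have K: "K > 0" using k by (simp add: K_def)
  have u0: "u \<ge> 0" using p p0 by (simp add: u_def)
  have v0: "v \<ge> 0" using p p0 by (simp add: v_def field_simps)
  have "ln (1 / p) \<le> 1 / p - 1" using p0 by (intro ln_le_minus_one) simp
  then have uv: "u \<le> v" using p0 by (simp add: u_def v_def ln_div)
  have "1 - p \<le> u" using ln_le_minus_one[OF p0] by (simp add: u_def)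
  moreover have "v = (1 + v) * (1 - p)" using p0 by (simp add: v_def field_simps)
  ultimately have "v \<le> (1 + v) * u" using v0 by (metis add_nonneg_nonneg mult_left_mono zero_le_one)
  then have vu: "v - u \<le> u * v" by (simp add: algebra_simps)
  have pos: "1 + K * u > 0" "1 + K * v > 0"
    using K u0 v0 by (simp_all add: add_pos_nonneg)
  have classical: "to_boolean (p ^ k) = 1 / (1 + K * u)"
    using p0 by (simp add: to_boolean_def K_def u_def ln_realpow)
  have "K - (K - 1) * p = p * (1 + K * v)"
    using p0 by (simp add: v_def field_simps)
  then have boolean: "p / (K - (K - 1) * p) = 1 / (1 + K * v)"
    using p0 by simp
  have diff: "1 / (1 + K * u) - 1 / (1 + K * v) = K * (v - u) / ((1 + K * u) * (1 + K * v))"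
    using pos by (simp add: field_simps)
  have "K * (K * (v - u)) \<le> K * (K * (u * v))"
    using vu K by simp
  also have "\<dots> \<le> (1 + K * u) * (1 + K * v)"
    using K u0 v0 by (simp add: algebra_simps)
  finally have "K * (v - u) / ((1 + K * u) * (1 + K * v)) \<le> 1 / K"
    using K pos by (simp add: pos_divide_le_eq pos_le_divide_eq mult.commute)
  moreover have "0 \<le> K * (v - u) / ((1 + K * u) * (1 + K * v))"
    using K pos uv by simp
  ultimately show ?thesis
    unfolding classical boolean[unfolded K_def] using diff by (simp add: K_def)
qed

lemma powers_tendsto_iff:
  fixes p :: "nat \<Rightarrow> real" and k :: "nat \<Rightarrow> nat"
  assumes p: "\<And>n. p n \<in> {0..1}" and k: "\<And>n. k n > 0" "strict_mono k"
  defines "b \<equiv> \<lambda>n. p n / (real (k n) - (real (k n) - 1) * p n)"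
  assumes h: "h \<in> {0..1}"
  shows "(\<lambda>n. p n ^ k n) \<longlonglongrightarrow> h \<longleftrightarrow> b \<longlonglongrightarrow> to_boolean h"
proof -
  have pk: "p n ^ k n \<in> {0..1}" for n
    using p[of n] by (simp add: power_le_one)
  have "filterlim (\<lambda>n. real (k n)) at_top sequentially"
    using filterlim_compose[OF filterlim_real_sequentially filterlim_subseq[OF k(2)]] .
  then have small: "(\<lambda>n. 1 / real (k n)) \<longlonglongrightarrow> 0"
    by (rule tendsto_divide_0[OF tendsto_const filterlim_at_top_imp_at_infinity])
  have "\<bar>b n - to_boolean (p n ^ k n)\<bar> \<le> 1 / real (k n)" for n
    unfolding b_def by (rule boolean_power_error[OF p k(1)])
  then have error: "(\<lambda>n. b n - to_boolean (p n ^ k n)) \<longlonglongrightarrow> 0"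
    by (intro Lim_null_comparison[OF _ small] always_eventually) simp
  show ?thesis
  proof
    assume "(\<lambda>n. p n ^ k n) \<longlonglongrightarrow> h"
    then have "(\<lambda>n. to_boolean (p n ^ k n)) \<longlonglongrightarrow> to_boolean h"
      using h pk by (intro continuous_on_tendsto_compose[OF continuous_to_boolean]) simp_all
    from tendsto_add[OF error this] show "b \<longlonglongrightarrow> to_boolean h" by simp
  next
    assume "b \<longlonglongrightarrow> to_boolean h"
    from tendsto_diff[OF this error] have "(\<lambda>n. to_boolean (p n ^ k n)) \<longlonglongrightarrow> to_boolean h"
      by simp
    then have "(\<lambda>n. to_classical (to_boolean (p n ^ k n))) \<longlonglongrightarrow> to_classical (to_boolean h)"
      using to_boolean_bounds[OF h] to_boolean_bounds[OF pk]
      by (intro continuous_on_tendsto_compose[OF continuous_to_classical]) simp_all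
    then show "(\<lambda>n. p n ^ k n) \<longlonglongrightarrow> h"
      using to_classical_to_boolean h pk by simp
  qed
qed

section \<open>Reparametrising the values of distribution functions\<close>

lemma Delta_plus_bounds:
  assumes "F \<in> Delta_plus"
  shows "F x \<in> {0..1}"
proof -
  obtain M where M: "real_distribution M" "F = cdf M"
    using assms by (auto simp: Delta_plus_def)
  then interpret real_distribution M by simp
  show ?thesis using M(2) cdf_nonneg cdf_bounded_prob by simp
qed

lemma Delta_plus_compose:
  fixes \<theta> :: "real \<Rightarrow> real"
  assumes F: "F \<in> Delta_plus"
    and \<theta>: "continuous_on {0..1} \<theta>" "mono_on {0..1} \<theta>" "\<theta> 0 = 0" "\<theta> 1 = 1"
  shows "\<theta> \<circ> F \<in> Delta_plus"
proof -
  obtain M where M: "real_distribution M" "F = cdf M" and neg: "\<And>x. x < 0 \<Longrightarrow> F x = 0"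
    using F by (auto simp: Delta_plus_def)
  then interpret real_distribution M by simp
  note tendsto_\<theta> = continuous_on_tendsto_compose[OF \<theta>(1)]
  have mono: "(\<theta> \<circ> F) x \<le> (\<theta> \<circ> F) y" if "x \<le> y" for x y
    using that cdf_nondecreasing[of x y] Delta_plus_bounds[OF F] M(2)
    by (auto intro!: mono_onD[OF \<theta>(2)])
  have right: "continuous (at_right a) (\<theta> \<circ> F)" for a
    using tendsto_\<theta>[of F "F a" "at_right a"] cdf_is_right_cont[of a] Delta_plus_bounds[OF F] M(2)
    by (simp add: continuous_within comp_def)
  have top: "((\<theta> \<circ> F) \<longlongrightarrow> 1) at_top"
    using tendsto_\<theta>[of F 1 at_top] cdf_lim_at_top_prob Delta_plus_bounds[OF F] M(2) \<theta>(4)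
    by (simp add: comp_def)
  have bot: "((\<theta> \<circ> F) \<longlongrightarrow> 0) at_bot"
    using tendsto_\<theta>[of F 0 at_bot] cdf_lim_at_bot Delta_plus_bounds[OF F] M(2) \<theta>(3)
    by (simp add: comp_def)
  have "real_distribution (interval_measure (\<theta> \<circ> F))"
    using mono right bot top by (intro real_distribution_interval_measure)
  moreover have "\<theta> \<circ> F = cdf (interval_measure (\<theta> \<circ> F))"
    using cdf_interval_measure[OF mono right bot] by simp
  ultimately show ?thesis
    using neg \<theta>(3) by (auto simp: Delta_plus_def)
qed

text \<open>The continuous left inverse \<open>\<eta>\<close> ensures that \<open>\<theta> \<circ> H\<close> has no continuity points beyond those
  of \<open>H\<close>; at any others the hypothesis would give no information.\<close>

lemma weak_conv_transport:
  fixes \<theta> \<eta> :: "real \<Rightarrow> real"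
  assumes AH: "weak_conv A H" and H: "\<And>x. H x \<in> {0..1}"
    and \<theta>: "\<And>t. t \<in> {0..1} \<Longrightarrow> \<theta> t \<in> {0..1}"
    and \<eta>: "continuous_on {0..1} \<eta>" "\<And>t. t \<in> {0..1} \<Longrightarrow> \<eta> (\<theta> t) = t"
    and transfer: "\<And>x h. h \<in> {0..1} \<Longrightarrow> (\<lambda>n. A n x) \<longlonglongrightarrow> h \<Longrightarrow> (\<lambda>n. B n x) \<longlonglongrightarrow> \<theta> h"
  shows "weak_conv B (\<theta> \<circ> H)"
  unfolding weak_conv_def
proof (intro allI impI)
  fix x assume "isCont (\<theta> \<circ> H) x"
  then have "((\<lambda>y. \<theta> (H y)) \<longlongrightarrow> \<theta> (H x)) (at x)"
    by (simp add: isCont_def comp_def)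
  then have "((\<lambda>y. \<eta> (\<theta> (H y))) \<longlongrightarrow> \<eta> (\<theta> (H x))) (at x)"
    using \<theta>[OF H] by (intro continuous_on_tendsto_compose[OF \<eta>(1)]) simp_all
  then have "isCont H x"
    using \<eta>(2)[OF H] by (simp add: isCont_def)
  then have "(\<lambda>n. A n x) \<longlonglongrightarrow> H x"
    using AH by (simp add: weak_conv_def)
  then show "(\<lambda>n. B n x) \<longlonglongrightarrow> (\<theta> \<circ> H) x"
    using transfer[OF H] by simp
qed

section \<open>Equivalence of the two limit problems\<close>

theorem theorem1p3:
  fixes F :: "nat \<Rightarrow> real \<Rightarrow> real" and k :: "nat \<Rightarrow> nat"
  assumes "\<And>n. F n \<in> Delta_plus"
    and "\<And>n. k n > 0"
    and "strict_mono k"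
  shows "(\<exists>H\<in>Delta_plus. weak_conv (\<lambda>n. conv_power max_conv (k n) (F n)) H) \<longleftrightarrow>
         (\<exists>G\<in>Delta_plus. weak_conv (\<lambda>n. conv_power bool_max_conv (k n) (F n)) G)"
    (is "(\<exists>H\<in>_. weak_conv ?A H) \<longleftrightarrow> (\<exists>G\<in>_. weak_conv ?B G)")
proof -
  have F: "F n x \<in> {0..1}" for n x
    using Delta_plus_bounds[OF assms(1)] .
  have A: "?A n = (\<lambda>x. F n x ^ k n)" for n
    using assms(2)[of n] by (intro conv_power_max_conv) simp
  have B: "?B n = (\<lambda>x. F n x / (real (k n) - (real (k n) - 1) * F n x))" for n
    using assms(2)[of n] F by (intro conv_power_bool_max_conv) auto
  have AB: "(\<lambda>n. ?A n x) \<longlonglongrightarrow> h \<longleftrightarrow> (\<lambda>n. ?B n x) \<longlonglongrightarrow> to_boolean h"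
    if "h \<in> {0..1}" for x h
    unfolding A B using powers_tendsto_iff[OF F assms(2,3) that] .
  show ?thesis
  proof
    assume "\<exists>H\<in>Delta_plus. weak_conv ?A H"
    then obtain H where H: "H \<in> Delta_plus" "weak_conv ?A H" by blast
    have "weak_conv ?B (to_boolean \<circ> H)"
      using H(2) Delta_plus_bounds[OF H(1)] to_boolean_bounds continuous_to_classical
        to_classical_to_boolean
      by (rule weak_conv_transport) (use AB in blast)+
    moreover have "to_boolean \<circ> H \<in> Delta_plus"
      using H(1) continuous_to_boolean mono_to_boolean
      by (rule Delta_plus_compose) (simp_all add: to_boolean_def)
    ultimately show "\<exists>G\<in>Delta_plus. weak_conv ?B G" by blast
  next
    assume "\<exists>G\<in>Delta_plus. weak_conv ?B G"
    then obtain G where G: "G \<in> Delta_plus" "weak_conv ?B G" by blast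
    have BA: "(\<lambda>n. ?A n x) \<longlonglongrightarrow> to_classical g"
      if "g \<in> {0..1}" "(\<lambda>n. ?B n x) \<longlonglongrightarrow> g" for x g
      using AB[OF to_classical_bounds[OF that(1)]] that(2) by (simp add: to_boolean_to_classical)
    have "weak_conv ?A (to_classical \<circ> G)"
      using G(2) Delta_plus_bounds[OF G(1)] to_classical_bounds continuous_to_boolean
        to_boolean_to_classical
      by (rule weak_conv_transport) (use BA in blast)+
    moreover have "to_classical \<circ> G \<in> Delta_plus"
      using G(1) continuous_to_classical mono_to_classical
      by (rule Delta_plus_compose) (simp_all add: to_classical_def)
    ultimately show "\<exists>H\<in>Delta_plus. weak_conv ?A H" by blast
  qed
qed

end
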